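(* Let $P(z,w)=\prod_{i=1}^\ell(1-\beta_i^vz^{-1})\det(\Phi(z)-wI)$ and let $K_{G_1}(z,w)$ be the magnetically altered Kasteleyn matrix. Then $$P(z,w)=\det K_{G_1}(z,w).$$
   Context: Fix integers $k,\ell\ge1$ and reals $\alpha_{j,i},\beta_{j,i},\gamma_{j,i}>0$ ($1\le j\le k$, $1\le i\le\ell$), and put $\beta_i^v=\prod_{j=1}^k\beta_{j,i}$. For $\vec\alpha,\vec\gamma\in\mathbb C^k$, $\phi^b(z;\vec\alpha,\vec\gamma)$ is the $k\times k$ matrix with diagonal entries $\gamma_1,\dots,\gamma_k$, entries $\alpha_r$ at position $(r+1,r)$ for $1\le r\le k-1$, entry $\alpha_kz^{-1}$ at position $(1,k)$, and zeros elsewhere (for $k=1$ it is $\gamma_1+\alpha_1z^{-1}$). For $\vec\beta\in\mathbb C^k$ and $\beta=\prod_{m=1}^k\beta_m$, $\phi^g(z;\vec\beta)$ is $(1-\beta z^{-1})^{-1}$ times the $k\times k$ matrix whose $(r,s)$ entry is $\prod_{m=s}^{r-1}\beta_m$ for $r\ge s$ and $z^{-1}\prod_{m=s}^{k}\beta_m\prod_{m=1}^{r-1}\beta_m$ for $r<s$. Write $\vec\alpha_i=(\alpha_{j,i})_{j=1}^k$, etc., and $\vec1=(1,\dots,1)$. Put $\phi_{2i-1}(z)=\phi^b(z;\vec\alpha_i,\vec\gamma_i)$, $\phi_{2i}(z)=\phi^g(z;\vec\beta_i)$ for $1\le i\le\ell$, and $\Phi(z)=\phi_1(z)\phi_2(z)\cdots\phi_{2\ell}(z)$.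 The matrix $K_{G_1}(z,w)$ is the $k\ell\times k\ell$ matrix consisting of $\ell\times\ell$ blocks of size $k\times k$: the $(i,i)$ block is $A_i=\phi^b(z;\vec\alpha_i,\vec\gamma_i)^T$ ($1\le i\le\ell$), the $(i,i+1)$ block is $B_i=-\phi^b(z;-\vec\beta_i,\vec1)^T$ ($1\le i\le\ell-1$), the $(\ell,1)$ block is $wB_\ell$ with $B_\ell=-\phi^b(z;-\vec\beta_\ell,\vec1)^T$, and all other blocks vanish (for $\ell=1$, $K_{G_1}=A_1+wB_1$). *)

theory Defs
  imports "HOL.Complex" "Jordan_Normal_Form.Determinant"
begin

text \<open>All indices are 1-based, as in the usual notation; \<open>sqmat1\<close> shifts them to the 0-based
  matrix entries of the library.\<close>

definition sqmat1 :: "nat \<Rightarrow> (nat \<Rightarrow> nat \<Rightarrow> 'a) \<Rightarrow> 'a mat" where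
  "sqmat1 n f = mat n n (\<lambda>(r, s). f (r + 1) (s + 1))"

text \<open>Contributions are summed, so that for \<open>k = 1\<close>, where the positions \<open>(1,1)\<close> and \<open>(1,k)\<close>
  coincide, the single entry is \<open>\<gamma> 1 + \<alpha> 1 / z\<close>.  For \<open>k > 1\<close> at most one summand is nonzero.\<close>

definition phi_b :: "nat \<Rightarrow> complex \<Rightarrow> (nat \<Rightarrow> complex) \<Rightarrow> (nat \<Rightarrow> complex) \<Rightarrow> complex mat" where
  "phi_b k z \<alpha> \<gamma> = sqmat1 k (\<lambda>r s.
     (if r = s then \<gamma> r else 0)
     + (if r = s + 1 then \<alpha> s else 0)
     + (if r = 1 \<and> s = k then \<alpha> k * inverse z else 0))"

definition phi_g :: "nat \<Rightarrow> complex \<Rightarrow> (nat \<Rightarrow> complex) \<Rightarrow> complex mat" where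
  "phi_g k z \<beta> = inverse (1 - (\<Prod>m=1..k. \<beta> m) * inverse z) \<cdot>\<^sub>m
     sqmat1 k (\<lambda>r s.
       if r \<ge> s then (\<Prod>m=s..<r. \<beta> m)
       else inverse z * (\<Prod>m=s..k. \<beta> m) * (\<Prod>m=1..<r. \<beta> m))"

text \<open>A parameter array \<open>a\<close> is written \<open>a j i\<close> with \<open>1 \<le> j \<le> k\<close> and \<open>1 \<le> i \<le> l\<close>.\<close>

definition par_vec :: "(nat \<Rightarrow> nat \<Rightarrow> real) \<Rightarrow> nat \<Rightarrow> nat \<Rightarrow> complex" where
  "par_vec a i = (\<lambda>j. complex_of_real (a j i))"

definition beta_v :: "nat \<Rightarrow> (nat \<Rightarrow> nat \<Rightarrow> real) \<Rightarrow> nat \<Rightarrow> real" where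
  "beta_v k \<beta> i = (\<Prod>j=1..k. \<beta> j i)"

definition phi_factor ::
  "nat \<Rightarrow> (nat \<Rightarrow> nat \<Rightarrow> real) \<Rightarrow> (nat \<Rightarrow> nat \<Rightarrow> real) \<Rightarrow> (nat \<Rightarrow> nat \<Rightarrow> real) \<Rightarrow> complex \<Rightarrow> nat \<Rightarrow> complex mat"
where
  "phi_factor k \<alpha> \<beta> \<gamma> z m =
     (if odd m then phi_b k z (par_vec \<alpha> ((m + 1) div 2)) (par_vec \<gamma> ((m + 1) div 2))
      else phi_g k z (par_vec \<beta> (m div 2)))"

definition Phi ::
  "nat \<Rightarrow> nat \<Rightarrow> (nat \<Rightarrow> nat \<Rightarrow> real) \<Rightarrow> (nat \<Rightarrow> nat \<Rightarrow> real) \<Rightarrow> (nat \<Rightarrow> nat \<Rightarrow> real) \<Rightarrow> complex \<Rightarrow> complex mat"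
where
  "Phi k l \<alpha> \<beta> \<gamma> z = foldr (\<lambda>m M. phi_factor k \<alpha> \<beta> \<gamma> z m * M) [1..<2 * l + 1] (1\<^sub>m k)"

text \<open>The defining formula is meaningful only for \<open>z \<noteq> 0\<close> and \<open>z \<noteq> beta_v k \<beta> i\<close>, the poles of
  \<open>phi_g\<close>; at those excluded points \<open>inverse 0 = 0\<close> gives values that are not the continuation
  of the rational function.\<close>

definition char_P ::
  "nat \<Rightarrow> nat \<Rightarrow> (nat \<Rightarrow> nat \<Rightarrow> real) \<Rightarrow> (nat \<Rightarrow> nat \<Rightarrow> real) \<Rightarrow> (nat \<Rightarrow> nat \<Rightarrow> real)
    \<Rightarrow> complex \<Rightarrow> complex \<Rightarrow> complex"
where
  "char_P k l \<alpha> \<beta> \<gamma> z w =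
     (\<Prod>i=1..l. 1 - complex_of_real (beta_v k \<beta> i) * inverse z)
     * det (Phi k l \<alpha> \<beta> \<gamma> z - w \<cdot>\<^sub>m 1\<^sub>m k)"

definition block_A ::
  "nat \<Rightarrow> (nat \<Rightarrow> nat \<Rightarrow> real) \<Rightarrow> (nat \<Rightarrow> nat \<Rightarrow> real) \<Rightarrow> complex \<Rightarrow> nat \<Rightarrow> complex mat" where
  "block_A k \<alpha> \<gamma> z i = transpose_mat (phi_b k z (par_vec \<alpha> i) (par_vec \<gamma> i))"

definition block_B :: "nat \<Rightarrow> (nat \<Rightarrow> nat \<Rightarrow> real) \<Rightarrow> complex \<Rightarrow> nat \<Rightarrow> complex mat" where
  "block_B k \<beta> z i = - transpose_mat (phi_b k z (\<lambda>j. - par_vec \<beta> i j) (\<lambda>_. 1))"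

text \<open>Again contributions are summed: for \<open>l = 1\<close> the only block is \<open>A 1 + w * B 1\<close>.\<close>

definition K_block ::
  "nat \<Rightarrow> nat \<Rightarrow> (nat \<Rightarrow> nat \<Rightarrow> real) \<Rightarrow> (nat \<Rightarrow> nat \<Rightarrow> real) \<Rightarrow> (nat \<Rightarrow> nat \<Rightarrow> real)
    \<Rightarrow> complex \<Rightarrow> complex \<Rightarrow> nat \<Rightarrow> nat \<Rightarrow> complex mat"
where
  "K_block k l \<alpha> \<beta> \<gamma> z w i j =
     (if i = j then block_A k \<alpha> \<gamma> z i else 0\<^sub>m k k)
     + (if j = i + 1 then block_B k \<beta> z i else 0\<^sub>m k k)
     + (if i = l \<and> j = 1 then w \<cdot>\<^sub>m block_B k \<beta> z l else 0\<^sub>m k k)"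

definition K_G1 ::
  "nat \<Rightarrow> nat \<Rightarrow> (nat \<Rightarrow> nat \<Rightarrow> real) \<Rightarrow> (nat \<Rightarrow> nat \<Rightarrow> real) \<Rightarrow> (nat \<Rightarrow> nat \<Rightarrow> real)
    \<Rightarrow> complex \<Rightarrow> complex \<Rightarrow> complex mat"
where
  "K_G1 k l \<alpha> \<beta> \<gamma> z w = mat (k * l) (k * l) (\<lambda>(p, q).
     K_block k l \<alpha> \<beta> \<gamma> z w (p div k + 1) (q div k + 1) $$ (p mod k, q mod k))"

end

theory Submission
  imports Defs
begin

text \<open>Write \<open>a\<^sub>i\<close> for the \<open>i\<close>-th matrix \<open>phi_b\<close>, \<open>G\<^sub>i\<close> for the \<open>i\<close>-th matrix \<open>phi_g\<close> and \<open>c\<^sub>i\<close> for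
  \<open>phi_b\<close> with parameters \<open>-\<beta>\<^sub>i\<close> and \<open>1\<close>. Then \<open>c\<^sub>i G\<^sub>i = 1\<close> and \<open>det c\<^sub>i = 1 - \<beta>\<^sub>i\<^sup>v / z\<close>. The transpose of the
  Kasteleyn matrix is block bidiagonal up to one corner: it has \<open>a\<^sub>i\<close> on the diagonal, \<open>-c\<^sub>i\<close> below it
  and \<open>-w c\<^sub>l\<close> in the upper right corner. Multiplying it on the right by the block diagonal matrix of
  the \<open>G\<^sub>i\<close> turns the blocks into \<open>X\<^sub>i = a\<^sub>i G\<^sub>i\<close>, \<open>-1\<close> and \<open>-w\<close>. Block row operations of determinant 1
  then replace \<open>X\<^sub>1, X\<^sub>2\<close> by their product and drop one block row and column; iterating this leaves
  \<open>det (X\<^sub>1 \<cdots> X\<^sub>l - w)\<close>.\<close>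

section \<open>Square matrices assembled from k by k blocks\<close>

text \<open>Block indices start at 0, so that \<open>div\<close> and \<open>mod\<close> read off the
  block and the position inside it, and dropping the first block row and column is a shift by
  \<open>Suc\<close>.\<close>

definition block_mat :: "nat \<Rightarrow> nat \<Rightarrow> (nat \<Rightarrow> nat \<Rightarrow> 'a mat) \<Rightarrow> 'a mat" where
  "block_mat k l F = mat (k * l) (k * l) (\<lambda>(p, q). F (p div k) (q div k) $$ (p mod k, q mod k))"

lemma block_mat_carrier [simp]: "block_mat k l F \<in> carrier_mat (k * l) (k * l)"
  by (simp add: block_mat_def)

lemma div_less_nat: "p < k * l \<Longrightarrow> p div k < (l::nat)"
  by (simp add: less_mult_imp_div_less mult.commute)

lemma block_mat_cong:
  assumes "\<And>i j. i < l \<Longrightarrow> j < l \<Longrightarrow> F i j = G i j"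
  shows "block_mat k l F = block_mat k l G"
  unfolding block_mat_def by (rule cong_mat) (auto simp: assms div_less_nat)

lemma block_mat_Suc:
  assumes "F 0 0 \<in> carrier_mat k k"
  shows "block_mat k (Suc l) F = four_block_mat (F 0 0)
    (mat k (k * l) (\<lambda>(p, q). F 0 (Suc (q div k)) $$ (p, q mod k)))
    (mat (k * l) k (\<lambda>(p, q). F (Suc (p div k)) 0 $$ (p mod k, q)))
    (block_mat k l (\<lambda>i j. F (Suc i) (Suc j)))" (is "?L = ?R")
proof (rule eq_matI)
  fix p q assume "p < dim_row ?R" "q < dim_col ?R"
  then have p: "p < k + k * l" and q: "q < k + k * l"
    using assms by (auto simp: block_mat_def)
  have k: "k > 0" using p by (cases k) auto
  show "?L $$ (p, q) = ?R $$ (p, q)"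
    using p q k assms
    by (auto simp: block_mat_def le_div_geq le_mod_geq not_less)
qed (use assms in \<open>auto simp: block_mat_def\<close>)

section \<open>Block elimination and the determinant of the cyclic pattern\<close>

text \<open>Row operations with multipliers \<open>A T\<close>, \<open>-T\<close> and \<open>E\<close>, first clear \<open>A\<close>, then
  turn it into \<open>1\<close>, then clear \<open>-E\<close>; this avoids tracking the sign of a block row swap.
  \<open>R\<close> combines the first two.\<close>

lemma det_four_block_eliminate:
  fixes A :: "'a :: idom mat"
  assumes A: "A \<in> carrier_mat k k" and B: "B \<in> carrier_mat k n"
    and E: "E \<in> carrier_mat n k" and D: "D \<in> carrier_mat n n"
    and T: "T \<in> carrier_mat k n" and TE: "T * E = 1\<^sub>m k"
  shows "det (four_block_mat A B (- E) D) = det (D + E * (B + (A - 1\<^sub>m k) * (T * D)))"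
proof -
  define R where "R = (A - 1\<^sub>m k) * T"
  define M where "M = B + R * D"
  have A1: "A - 1\<^sub>m k \<in> carrier_mat k k" by (simp add: minus_carrier_mat)
  have R: "R \<in> carrier_mat k n" using A1 T by (simp add: R_def)
  have M: "M \<in> carrier_mat k n" using R D B by (simp add: M_def)
  have RE: "R * E = A - 1\<^sub>m k"
    using A1 T E TE by (simp add: R_def assoc_mult_mat[of _ k k _ n _ k])
  let ?U = "four_block_mat (1\<^sub>m k) R (0\<^sub>m n k) (1\<^sub>m n)"
  let ?V = "four_block_mat (1\<^sub>m k) (0\<^sub>m k n) E (1\<^sub>m n)"
  let ?F = "four_block_mat A B (- E) D"
  have UF: "?U * ?F = four_block_mat (1\<^sub>m k) M (- E) D"
  proof -
    have "A + R * - E = 1\<^sub>m k"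
      using A R E RE by (auto simp: uminus_mult_right_mat[symmetric])
    then show ?thesis
      using A B E D R unfolding M_def
      by (subst mult_four_block_mat[of _ k k _ n _ n]) auto
  qed
  have VUF: "?V * (?U * ?F) = four_block_mat (1\<^sub>m k) M (0\<^sub>m n k) (D + E * M)"
  proof -
    have "E * M + D = D + E * M" using E M D by (auto intro: comm_add_mat)
    then show ?thesis
      unfolding UF using E D M
      by (subst mult_four_block_mat[of _ k k _ n _ n]) auto
  qed
  have dU: "det ?U = 1" using R by (subst det_four_block_mat_lower_left_zero) auto
  have dV: "det ?V = 1" using E by (subst det_four_block_mat_upper_right_zero) auto
  have F: "?F \<in> carrier_mat (k + n) (k + n)" using A D by simp
  have U: "?U \<in> carrier_mat (k + n) (k + n)" and V: "?V \<in> carrier_mat (k + n) (k + n)" by auto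
  have "det (?V * (?U * ?F)) = det ?F"
    by (simp only: det_mult[OF V mult_carrier_mat[OF U F]] det_mult[OF U F] dU dV mult_1)
  also have "det (?V * (?U * ?F)) = det (D + E * M)"
    unfolding VUF using M D E by (subst det_four_block_mat_lower_left_zero) auto
  finally show ?thesis
    using A1 T D by (simp add: M_def R_def assoc_mult_mat[of _ k k _ n _ n])
qed

text \<open>The preceding elimination is applied with \<open>E\<close> the embedding of the first
  \<open>k\<close> coordinates. The correction then affects only the first block row of
  \<open>D\<close>; there the block \<open>d\<close> of \<open>D\<close> and the block
  \<open>b\<close> of \<open>B\<close> combine to
  \<open>d + b + (F 0 0 - 1) d = b + F 0 0 * d\<close>.\<close>

lemma det_block_mat_eliminate:
  fixes F :: "nat \<Rightarrow> nat \<Rightarrow> 'a :: idom mat"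
  assumes F: "\<And>i j. F i j \<in> carrier_mat k k" and l: "l \<ge> 1"
    and F10: "F (Suc 0) 0 = - 1\<^sub>m k" and Fi0: "\<And>i. 2 \<le> i \<Longrightarrow> i \<le> l \<Longrightarrow> F i 0 = 0\<^sub>m k k"
  shows "det (block_mat k (Suc l) F) =
    det (block_mat k l (\<lambda>i j. if i = 0 then F 0 (Suc j) + F 0 0 * F (Suc 0) (Suc j)
      else F (Suc i) (Suc j)))" (is "_ = det ?G")
proof -
  define n where "n = k * l"
  \<comment> \<open>At least one full block lies below \<open>F 0 0\<close>, which is what makes
    \<open>T\<close> a left inverse of \<open>E\<close>.\<close>
  have kn: "k \<le> n" using l by (cases l) (auto simp: n_def)
  define E :: "'a mat" where "E = mat n k (\<lambda>(p, q). if p = q then 1 else 0)"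
  define T :: "'a mat" where "T = mat k n (\<lambda>(p, q). if p = q then 1 else 0)"
  define B where "B = mat k n (\<lambda>(p, q). F 0 (Suc (q div k)) $$ (p, q mod k))"
  define D where "D = block_mat k l (\<lambda>i j. F (Suc i) (Suc j))"
  have E: "E \<in> carrier_mat n k" and T: "T \<in> carrier_mat k n" and B: "B \<in> carrier_mat k n"
    and D: "D \<in> carrier_mat n n" by (auto simp: E_def T_def B_def D_def n_def)
  \<comment> \<open>\<open>T\<close> keeps the first \<open>k\<close> rows of a matrix, and
    \<open>E\<close> pads a matrix with zero rows.\<close>
  have TM: "T * M = mat k m (\<lambda>(p, q). M $$ (p, q))" if "M \<in> carrier_mat n m" for M m
    using that kn
    by (intro eq_matI) (auto simp: T_def scalar_prod_def if_distrib[where f = "\<lambda>x. x * _"] cong: if_cong)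
  have EM: "E * M = mat n m (\<lambda>(p, q). if p < k then M $$ (p, q) else 0)"
    if "M \<in> carrier_mat k m" for M m
    using that kn
    by (intro eq_matI) (auto simp: E_def scalar_prod_def if_distrib[where f = "\<lambda>x. x * _"] cong: if_cong)
  have TE: "T * E = 1\<^sub>m k"
    using kn by (subst TM[OF E]) (auto intro!: eq_matI simp: E_def)
  \<comment> \<open>Below \<open>F 0 0\<close> the first block column reads -1, 0, ..., 0.\<close>
  have col: "mat n k (\<lambda>(p, q). F (Suc (p div k)) 0 $$ (p mod k, q)) = - E" (is "?C = _")
  proof (rule eq_matI)
    fix p q assume "p < dim_row (- E)" "q < dim_col (- E)"
    then have p: "p < n" and q: "q < k" using E by auto
    have "p div k < l" using p div_less_nat n_def by auto
    then have "F (Suc (p div k)) 0 = (if p div k = 0 then - 1\<^sub>m k else 0\<^sub>m k k)"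
      using F10 Fi0[of "Suc (p div k)"] by auto
    moreover have "p div k = 0 \<longleftrightarrow> p < k" using q by (auto simp: div_eq_0_iff)
    ultimately show "?C $$ (p, q) = (- E) $$ (p, q)"
      using p q by (auto simp: E_def)
  qed (auto simp: E_def)
  have "block_mat k (Suc l) F = four_block_mat (F 0 0) B (- E) D"
    unfolding block_mat_Suc[of F, OF F] col[symmetric] B_def D_def n_def ..
  then have "det (block_mat k (Suc l) F) =
      det (D + E * (B + (F 0 0 - 1\<^sub>m k) * (T * D)))"
    by (simp add: det_four_block_eliminate[OF F B E D T TE])
  also have "D + E * (B + (F 0 0 - 1\<^sub>m k) * (T * D)) = ?G" (is "?S = _")
  proof (rule eq_matI)
    fix p q assume "p < dim_row ?G" "q < dim_col ?G"
    then have p: "p < n" and q: "q < n" by (auto simp: block_mat_def n_def)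
    have k: "k > 0" using p by (cases k) (auto simp: n_def)
    have TD: "T * D \<in> carrier_mat k n" using T D by simp
    have Q: "(F 0 0 - 1\<^sub>m k) * (T * D) \<in> carrier_mat k n"
      using minus_carrier_mat[OF one_carrier_mat] TD by (rule mult_carrier_mat)
    then have M: "B + (F 0 0 - 1\<^sub>m k) * (T * D) \<in> carrier_mat k n"
      using B by simp
    have eq: "?S $$ (p, q) = D $$ (p, q)
        + (if p < k then (B + (F 0 0 - 1\<^sub>m k) * (T * D)) $$ (p, q) else 0)"
      using p q M E D by (simp add: EM[OF M])
    show "?S $$ (p, q) = ?G $$ (p, q)"
    proof (cases "p < k")
      case False
      then have "p div k \<noteq> 0" using k by (auto simp: div_eq_0_iff)
      then show ?thesis using False p q eq by (simp add: D_def block_mat_def n_def)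
    next
      case True
      have colTD: "col (T * D) q = col (F (Suc 0) (Suc (q div k))) (q mod k)"
      proof (rule eq_vecI)
        fix i assume "i < dim_vec (col (F (Suc 0) (Suc (q div k))) (q mod k))"
        then have i: "i < k" using F[of "Suc 0" "Suc (q div k)"] by simp
        have "col (T * D) q $ i = D $$ (i, q)" using i q by (simp add: TM[OF D])
        then show "col (T * D) q $ i = col (F (Suc 0) (Suc (q div k))) (q mod k) $ i"
          using F[of "Suc 0" "Suc (q div k)"] i k q order.strict_trans2[OF i kn] by (simp add: D_def block_mat_def n_def)
      qed (use F[of "Suc 0" "Suc (q div k)"] T in simp)
      \<comment> \<open>Splitting off the identity leaves a term \<open>- D\<close> that cancels the
        entry of \<open>D\<close> in \<open>eq\<close>.\<close>
      have "((F 0 0 - 1\<^sub>m k) * (T * D)) $$ (p, q) = (F 0 0 * (T * D)) $$ (p, q) - (T * D) $$ (p, q)"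
        using minus_mult_distrib_mat[OF F one_carrier_mat TD, of 0 0] T D F[of 0 0] True q
        by (simp add: left_mult_one_mat[OF TD])
      also have "(F 0 0 * (T * D)) $$ (p, q) = row (F 0 0) p \<bullet> col (T * D) q"
        using F[of 0 0] TD True q by (intro index_mult_mat(1)) (simp_all only: carrier_matD)
      also have "\<dots> = (F 0 0 * F (Suc 0) (Suc (q div k))) $$ (p, q mod k)"
        unfolding colTD using F[of 0 0] F[of "Suc 0" "Suc (q div k)"] True k by simp
      also have "(T * D) $$ (p, q) = D $$ (p, q)"
        using True q by (simp add: TM[OF D])
      finally have "((F 0 0 - 1\<^sub>m k) * (T * D)) $$ (p, q) =
        (F 0 0 * F (Suc 0) (Suc (q div k))) $$ (p, q mod k) - D $$ (p, q)" .
      moreover have "(B + (F 0 0 - 1\<^sub>m k) * (T * D)) $$ (p, q) =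
        B $$ (p, q) + ((F 0 0 - 1\<^sub>m k) * (T * D)) $$ (p, q)"
        using Q True q by (intro index_add_mat(1)) (simp_all only: carrier_matD)
      ultimately have "?S $$ (p, q) =
        B $$ (p, q) + (F 0 0 * F (Suc 0) (Suc (q div k))) $$ (p, q mod k)"
        using eq True by simp
      then show ?thesis
        using True p q k F[of 0 0] F[of "Suc 0" "Suc (q div k)"]
        by (simp add: block_mat_def n_def B_def)
    qed
  qed (use D E in \<open>auto simp: block_mat_def n_def\<close>)
  finally show ?thesis .
qed


text \<open>One elimination merges \<open>X 0\<close> and \<open>X 1\<close> into their product and
  keeps the pattern: only block row 1 gets multiplied by \<open>X 0\<close>, so the corner
  \<open>W\<close> in block row 0 survives. The induction starts at \<open>l = 1\<close>, where
  corner and diagonal coincide in the single block \<open>X 0 + W\<close>.\<close>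

lemma det_block_mat_cyclic:
  fixes X :: "nat \<Rightarrow> 'a :: idom mat"
  assumes "\<And>i. X i \<in> carrier_mat k k" and W: "W \<in> carrier_mat k k" and "l \<ge> 1"
  shows "det (block_mat k l (\<lambda>i j. (if i = j then X i else 0\<^sub>m k k)
      + (if i = Suc j then - 1\<^sub>m k else 0\<^sub>m k k)
      + (if i = 0 \<and> Suc j = l then W else 0\<^sub>m k k)))
    = det (foldr (\<lambda>i M. X i * M) [0..<l] (1\<^sub>m k) + W)"
  using assms(3,1)
proof (induction l arbitrary: X rule: dec_induct)
  case base
  have "block_mat k (Suc 0) F = F 0 0" if "F 0 0 \<in> carrier_mat k k" for F :: "nat \<Rightarrow> nat \<Rightarrow> 'a mat"
    using that by (auto simp: block_mat_def)
  then show ?case using base[of 0] W by simp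
next
  case (step l)
  note X = step.prems
  define Y where "Y i = (if i = 0 then X 0 * X (Suc 0) else X (Suc i))" for i
  have Y: "Y i \<in> carrier_mat k k" for i
    using X by (auto simp: Y_def intro: mult_carrier_mat)
  obtain m where m: "l = Suc m" using step.hyps by (cases l) auto
  have fold: "foldr (\<lambda>i M. X (Suc (Suc i)) * M) xs (1\<^sub>m k) \<in> carrier_mat k k" for xs
    by (induction xs) (auto intro!: mult_carrier_mat[of _ k k] X)
  have prod: "foldr (\<lambda>i M. Y i * M) [0..<l] (1\<^sub>m k) = foldr (\<lambda>i M. X i * M) [0..<Suc l] (1\<^sub>m k)"
    using fold X
    by (simp add: m upt_conv_Cons map_Suc_upt[symmetric] foldr_map o_def Y_def
        assoc_mult_mat[of _ k k _ k _ k] del: upt_Suc)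
  let ?F = "\<lambda>i j. (if i = j then X i else 0\<^sub>m k k) + (if i = Suc j then - 1\<^sub>m k else 0\<^sub>m k k)
      + (if i = 0 \<and> Suc j = Suc l then W else 0\<^sub>m k k)"
  have "det (block_mat k (Suc l) ?F) =
      det (block_mat k l (\<lambda>i j. if i = 0 then ?F 0 (Suc j) + ?F 0 0 * ?F (Suc 0) (Suc j)
      else ?F (Suc i) (Suc j)))"
    using X W step.hyps by (intro det_block_mat_eliminate) auto
  also have "\<dots> = det (block_mat k l (\<lambda>i j. (if i = j then Y i else 0\<^sub>m k k)
      + (if i = Suc j then - 1\<^sub>m k else 0\<^sub>m k k) + (if i = 0 \<and> Suc j = l then W else 0\<^sub>m k k)))"
  proof (intro arg_cong[where f = det] block_mat_cong)
    have X01: "X 0 * X (Suc 0) \<in> carrier_mat k k" using X X by (rule mult_carrier_mat)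
    \<comment> \<open>When \<open>l = 1\<close>, the corner and the merged product fall into the
      same block, in the opposite order.\<close>
    have "W + X 0 * X (Suc 0) = X 0 * X (Suc 0) + W"
      using W X01 by (rule comm_add_mat)
    moreover have "X 0 * 0\<^sub>m k k = 0\<^sub>m k k" using X by (rule right_mult_zero_mat)
    ultimately show "(if i = 0 then ?F 0 (Suc j) + ?F 0 0 * ?F (Suc 0) (Suc j)
        else ?F (Suc i) (Suc j)) = (if i = j then Y i else 0\<^sub>m k k)
        + (if i = Suc j then - 1\<^sub>m k else 0\<^sub>m k k) + (if i = 0 \<and> Suc j = l then W else 0\<^sub>m k k)"
      for i j
      using X X01 W step.hyps by (cases "l = 0") (auto simp: Y_def)
  qed
  also have "\<dots> = det (foldr (\<lambda>i M. X i * M) [0..<Suc l] (1\<^sub>m k) + W)"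
    using step.IH[of Y] Y prod by simp
  finally show ?case .
qed

section \<open>Block diagonal factors and general cyclic bidiagonal matrices\<close>

lemma sum_div_mod: "(\<Sum>t<k * l. h (t div k) (t mod k)) = (\<Sum>m<l. \<Sum>s<(k::nat). h m s)"
proof -
  have "(\<Sum>t\<in>{m * k..<m * k + k}. h (t div k) (t mod k)) = (\<Sum>s<k. h m s)" for m
    using sum.shift_bounds_nat_ivl[of "\<lambda>t. h (t div k) (t mod k)" 0 "m * k" k]
    by (auto simp: atLeast0LessThan add.commute intro!: sum.cong)
  then show ?thesis
    using sum.nat_group[of "\<lambda>t. h (t div k) (t mod k)" k l] by (simp add: mult.commute)
qed

lemma block_mat_mult_diag:
  fixes F :: "nat \<Rightarrow> nat \<Rightarrow> 'a :: comm_ring_1 mat"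
  assumes F: "\<And>i j. F i j \<in> carrier_mat k k" and G: "\<And>j. G j \<in> carrier_mat k k"
  shows "block_mat k l F * block_mat k l (\<lambda>i j. if i = j then G j else 0\<^sub>m k k)
    = block_mat k l (\<lambda>i j. F i j * G j)" (is "?L = ?R")
proof (rule eq_matI)
  fix p q assume "p < dim_row ?R" "q < dim_col ?R"
  then have p: "p < k * l" and q: "q < k * l" by (auto simp: block_mat_def)
  have k: "k > 0" using p by (cases k) auto
  let ?h = "\<lambda>m s. F (p div k) m $$ (p mod k, s) *
    (if m = q div k then G (q div k) else 0\<^sub>m k k) $$ (s, q mod k)"
  have "?L $$ (p, q) = (\<Sum>t<k * l. ?h (t div k) (t mod k))"
    using p q by (auto simp: block_mat_def scalar_prod_def atLeast0LessThan intro!: sum.cong)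
  also have "\<dots> = (\<Sum>m<l. \<Sum>s<k. ?h m s)" by (rule sum_div_mod)
  also have "\<dots> = (\<Sum>m<l. if m = q div k then
      \<Sum>s<k. F (p div k) (q div k) $$ (p mod k, s) * G (q div k) $$ (s, q mod k) else 0)"
    using k by (intro sum.cong) auto
  also have "\<dots> = (\<Sum>s<k. F (p div k) (q div k) $$ (p mod k, s) * G (q div k) $$ (s, q mod k))"
    using div_less_nat[OF q] by simp
  also have "\<dots> = ?R $$ (p, q)"
    using p q k F[of "p div k" "q div k"] G[of "q div k"]
    by (auto simp: block_mat_def scalar_prod_def atLeast0LessThan)
  finally show "?L $$ (p, q) = ?R $$ (p, q)" .
qed (auto simp: block_mat_def)

lemma det_block_mat_diag:
  fixes G :: "nat \<Rightarrow> 'a :: idom mat"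
  assumes "\<And>j. G j \<in> carrier_mat k k"
  shows "det (block_mat k l (\<lambda>i j. if i = j then G j else 0\<^sub>m k k)) = (\<Prod>i<l. det (G i))"
  using assms
proof (induction l arbitrary: G)
  case 0
  then show ?case by (simp add: block_mat_def)
next
  case (Suc l)
  have "mat (k * l) k (\<lambda>(p, q). (0\<^sub>m k k :: 'a mat) $$ (p mod k, q)) = 0\<^sub>m (k * l) k"
    by (intro eq_matI) auto
  then have "det (block_mat k (Suc l) (\<lambda>i j. if i = j then G j else 0\<^sub>m k k)) =
      det (G 0) * det (block_mat k l (\<lambda>i j. if i = j then G (Suc j) else 0\<^sub>m k k))"
    using Suc.prems[of 0]
    by (simp add: block_mat_Suc det_four_block_mat_lower_left_zero[where n = k and m = "k * l"])
  then show ?case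
    using Suc.IH[of "\<lambda>j. G (Suc j)"] Suc.prems by (simp add: prod.lessThan_Suc_shift del: prod.lessThan_Suc)
qed

text \<open>Every copy of \<open>c j\<close> stands in block column \<open>j\<close>, so a single
  block diagonal factor on the right normalises all of them and leaves the cyclic pattern with
  \<open>W = - w\<close>.\<close>

lemma det_block_mat_bidiagonal_cyclic:
  fixes a c G :: "nat \<Rightarrow> 'a :: idom mat"
  assumes a: "\<And>i. a i \<in> carrier_mat k k" and c: "\<And>i. c i \<in> carrier_mat k k"
    and G: "\<And>i. G i \<in> carrier_mat k k" and cG: "\<And>i. i < l \<Longrightarrow> c i * G i = 1\<^sub>m k" and l: "l \<ge> 1"
  shows "det (block_mat k l (\<lambda>i j. (if i = j then a i else 0\<^sub>m k k)
      + (if i = Suc j then - c j else 0\<^sub>m k k)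
      + (if i = 0 \<and> Suc j = l then - (w \<cdot>\<^sub>m c j) else 0\<^sub>m k k)))
    = (\<Prod>i<l. det (c i)) * det (foldr (\<lambda>i M. a i * G i * M) [0..<l] (1\<^sub>m k) - w \<cdot>\<^sub>m 1\<^sub>m k)"
    (is "det (block_mat k l ?F) = ?C * det (?P - _)")
proof -
  have F: "?F i j \<in> carrier_mat k k" for i j using a c by auto
  have aG: "a i * G i \<in> carrier_mat k k" for i using a G by (rule mult_carrier_mat)
  \<comment> \<open>\<open>?C\<close> is the inverse of the determinant of the block diagonal
    factor; this stands in for division in the ring \<open>'a\<close>.\<close>
  have "(\<Prod>i<l. det (c i)) * (\<Prod>i<l. det (G i)) = (\<Prod>i<l. det (c i * G i))"
    by (simp add: prod.distrib det_mult[OF c G])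
  also have "\<dots> = 1" by (intro prod.neutral ballI) (simp add: cG)
  finally have CG: "?C * (\<Prod>i<l. det (G i)) = 1" .
  have "det (block_mat k l ?F) * (\<Prod>i<l. det (G i)) = det (block_mat k l (\<lambda>i j. ?F i j * G j))"
    unfolding block_mat_mult_diag[of ?F, OF F G, symmetric]
    by (simp only: det_mult[OF block_mat_carrier block_mat_carrier] det_block_mat_diag[OF G])
  also have "block_mat k l (\<lambda>i j. ?F i j * G j) = block_mat k l (\<lambda>i j.
      (if i = j then a i * G i else 0\<^sub>m k k) + (if i = Suc j then - 1\<^sub>m k else 0\<^sub>m k k)
      + (if i = 0 \<and> Suc j = l then - (w \<cdot>\<^sub>m 1\<^sub>m k) else 0\<^sub>m k k))"
  proof (rule block_mat_cong)
    fix i j assume "i < l" "j < l"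
    have wcG: "(w \<cdot>\<^sub>m c j) * G j = w \<cdot>\<^sub>m 1\<^sub>m k"
      by (simp only: mult_smult_assoc_mat[OF c G] cG[OF \<open>j < l\<close>])
    have m: "- c j * G j = - 1\<^sub>m k" "- (w \<cdot>\<^sub>m c j) * G j = - (w \<cdot>\<^sub>m 1\<^sub>m k)"
      using cG[OF \<open>j < l\<close>] wcG c[of j] G[of j] by auto
    have distr: "(A + B + C) * G j = A * G j + B * G j + C * G j"
      if "A \<in> carrier_mat k k" "B \<in> carrier_mat k k" "C \<in> carrier_mat k k" for A B C
      by (simp only: add_mult_distrib_mat[OF add_carrier_mat[OF that(2)] that(3) G]
          add_mult_distrib_mat[OF that(1,2) G])
    have "0\<^sub>m k k * G j = 0\<^sub>m k k" using G by (rule left_mult_zero_mat)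
    then have ifs: "(if P then M else 0\<^sub>m k k) * G j = (if P then M * G j else 0\<^sub>m k k)" for P M
      by simp
    show "?F i j * G j = (if i = j then a i * G i else 0\<^sub>m k k)
      + (if i = Suc j then - 1\<^sub>m k else 0\<^sub>m k k)
      + (if i = 0 \<and> Suc j = l then - (w \<cdot>\<^sub>m 1\<^sub>m k) else 0\<^sub>m k k)"
    proof (subst distr)
      show "(if i = j then a i else 0\<^sub>m k k) * G j + (if i = Suc j then - c j else 0\<^sub>m k k) * G j
          + (if i = 0 \<and> Suc j = l then - (w \<cdot>\<^sub>m c j) else 0\<^sub>m k k) * G j
        = (if i = j then a i * G i else 0\<^sub>m k k)
          + (if i = Suc j then - 1\<^sub>m k else 0\<^sub>m k k)
          + (if i = 0 \<and> Suc j = l then - (w \<cdot>\<^sub>m 1\<^sub>m k) else 0\<^sub>m k k)"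
        unfolding ifs m by (cases "i = j") (simp_all only: if_True if_False)
    qed (use a c in auto)
  qed
  also have "det \<dots> = det (?P + - (w \<cdot>\<^sub>m 1\<^sub>m k))"
    using aG l by (intro det_block_mat_cyclic) auto
  finally have "det (block_mat k l ?F) * (\<Prod>i<l. det (G i)) = det (?P + - (w \<cdot>\<^sub>m 1\<^sub>m k))" .
  moreover have "?P + - (w \<cdot>\<^sub>m 1\<^sub>m k) = ?P - w \<cdot>\<^sub>m 1\<^sub>m k"
  proof -
    have "foldr (\<lambda>i M. a i * G i * M) xs (1\<^sub>m k) \<in> carrier_mat k k" for xs
      by (induction xs) (auto intro!: mult_carrier_mat[of _ k k] aG)
    then show ?thesis by (auto simp: add_uminus_minus_mat[of _ k k])
  qed
  ultimately have "det (block_mat k l ?F) * (\<Prod>i<l. det (G i)) = det (?P - w \<cdot>\<^sub>m 1\<^sub>m k)" by simp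
  \<comment> \<open>Cancellation of \<open>v\<close>, the product of the \<open>det (G i)\<close>,
    by means of its inverse \<open>y = ?C\<close>.\<close>
  moreover have "x = y * u" if "x * v = u" "y * v = 1" for x y u v :: 'a
    using that by (auto simp: mult.left_commute[of y])
  ultimately show ?thesis using CG by blast
qed

section \<open>The matrices \<open>phi_b\<close> and \<open>phi_g\<close>\<close>

lemma phi_b_carrier [simp]: "phi_b k z \<alpha> \<gamma> \<in> carrier_mat k k"
  by (simp add: phi_b_def sqmat1_def)

lemma phi_g_carrier [simp]: "phi_g k z \<beta> \<in> carrier_mat k k"
  by (simp add: phi_g_def sqmat1_def)

text \<open>A row of \<open>phi_b\<close> meets only its own column and the cyclically preceding
  one; for \<open>k = 1\<close> these coincide and the contributions add. Since \<open>p\<close> is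
  0-based, the entry left of the diagonal is \<open>\<alpha> p\<close>.\<close>

lemma phi_b_mult_index:
  assumes M: "M \<in> carrier_mat k k" and p: "p < k" and q: "q < k"
  shows "(phi_b k z \<alpha> \<gamma> * M) $$ (p, q) = \<gamma> (p + 1) * M $$ (p, q)
    + (if p = 0 then \<alpha> k * inverse z * M $$ (k - 1, q) else \<alpha> p * M $$ (p - 1, q))"
proof -
  have "(phi_b k z \<alpha> \<gamma> * M) $$ (p, q) = (\<Sum>t<k. phi_b k z \<alpha> \<gamma> $$ (p, t) * M $$ (t, q))"
    using M p q phi_b_carrier[of k z \<alpha> \<gamma>]
    by (auto simp: scalar_prod_def atLeast0LessThan simp del: phi_b_carrier)
  also have "\<dots> = (\<Sum>t<k. (if t = p then \<gamma> (p + 1) * M $$ (p, q) else 0)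
      + ((if p > 0 \<and> t = p - 1 then \<alpha> p * M $$ (p - 1, q) else 0)
      + (if p = 0 \<and> t = k - 1 then \<alpha> k * inverse z * M $$ (k - 1, q) else 0)))"
    using p by (intro sum.cong) (auto simp: phi_b_def sqmat1_def algebra_simps)
  also have "\<dots> = \<gamma> (p + 1) * M $$ (p, q)
      + (if p = 0 then \<alpha> k * inverse z * M $$ (k - 1, q) else \<alpha> p * M $$ (p - 1, q))"
    using p by (cases "p = 0") (simp_all add: sum.distrib)
  finally show ?thesis .
qed

text \<open>The left factor is \<open>1 - S\<close> for a weighted cyclic shift \<open>S\<close>
  whose \<open>k\<close>-th power is the scalar
  \<open>(\<Prod>m=1..k. \<beta> m) * inverse z\<close>. Summing the geometric series of
  \<open>S\<close> gives \<open>phi_g\<close>: its entry at \<open>(r, s)\<close> is the weight of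
  the path from \<open>s\<close> to \<open>r\<close>, through the wrap-around if
  \<open>r < s\<close>, divided by 1 minus that scalar.\<close>

lemma phi_b_mult_phi_g:
  assumes b: "(\<Prod>m=1..k. \<beta> m) * inverse z \<noteq> 1"
  shows "phi_b k z (\<lambda>j. - \<beta> j) (\<lambda>_. 1) * phi_g k z \<beta> = 1\<^sub>m k" (is "?L = _")
proof (rule eq_matI)
  fix p q assume "p < dim_row (1\<^sub>m k)" "q < dim_col (1\<^sub>m k :: complex mat)"
  then have p: "p < k" and q: "q < k" by auto
  define g where "g r s = (if r \<ge> s then (\<Prod>m=s..<r. \<beta> m)
       else inverse z * (\<Prod>m=s..k. \<beta> m) * (\<Prod>m=1..<r. \<beta> m))" for r s
  define d where "d = 1 - (\<Prod>m=1..k. \<beta> m) * inverse z"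
  have d: "d \<noteq> 0" using b by (simp add: d_def)
  have G: "phi_g k z \<beta> $$ (i, q) = inverse d * g (i + 1) (q + 1)" if "i < k" for i
    using that q by (simp add: phi_g_def sqmat1_def g_def d_def)
  \<comment> \<open>Extending the path by one step multiplies its weight, so consecutive rows
    cancel. On the diagonal the empty path of weight 1 meets the full cycle, which leaves
    \<open>d\<close>.\<close>
  have *: "g (p + 1) (q + 1) + (if p = 0 then - \<beta> k * inverse z * g k (q + 1)
      else - \<beta> p * g p (q + 1)) = (if p = q then d else 0)"
  proof (cases "p = 0")
    case True
    have "(\<Prod>m=s..<k. \<beta> m) * \<beta> k = (\<Prod>m=s..k. \<beta> m)" if "s \<le> k" for s
      using that by (simp add: prod.last_plus mult.commute)
    from this[of "q + 1"] show ?thesis using q True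
      by (auto simp: g_def d_def algebra_simps)
  next
    case False
    have last: "(\<Prod>m=s..<p + 1. \<beta> m) = (\<Prod>m=s..<p. \<beta> m) * \<beta> p" if "s \<le> p" for s
      using that by (simp add: mult.commute)
    have split: "(\<Prod>m=1..<p + 1. \<beta> m) * (\<Prod>m=p + 1..k. \<beta> m) = (\<Prod>m=1..k. \<beta> m)"
      using p prod.ub_add_nat[of 1 p \<beta> "k - p"]
      by (simp add: atLeastLessThanSuc_atLeastAtMost)
    consider "q < p" | "q = p" | "p < q" by linarith
    then show ?thesis
    proof cases
      case 1
      then show ?thesis using \<open>p \<noteq> 0\<close> by (simp add: g_def)
    next
      case 2
      then show ?thesis using \<open>p \<noteq> 0\<close> last[of 1] split
        by (simp add: g_def d_def algebra_simps)
    next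
      case 3
      then show ?thesis using \<open>p \<noteq> 0\<close> last[of 1] by (simp add: g_def)
    qed
  qed
  have "?L $$ (p, q) = inverse d * (g (p + 1) (q + 1) +
      (if p = 0 then - \<beta> k * inverse z * g k (q + 1) else - \<beta> p * g p (q + 1)))"
    using p q by (simp add: phi_b_mult_index G algebra_simps)
  then show "?L $$ (p, q) = 1\<^sub>m k $$ (p, q)"
    unfolding * using d p q by simp
qed (auto simp: phi_b_def phi_g_def sqmat1_def)

text \<open>For blocks of size 1, the cyclic determinant formula evaluates \<open>det \<circ> phi_b\<close> itself,
  with \<open>inverse z\<close> in the role of \<open>w\<close>.\<close>

lemma det_phi_b_one:
  assumes k: "k \<ge> 1" and b: "\<And>j. 1 \<le> j \<Longrightarrow> j \<le> k \<Longrightarrow> \<beta> j \<noteq> 0"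
  shows "det (phi_b k z (\<lambda>j. - \<beta> j) (\<lambda>_. 1)) = 1 - (\<Prod>m=1..k. \<beta> m) * inverse z"
proof -
  \<comment> \<open>The entries of \<open>phi_b\<close> serve as 1 by 1 blocks; nonzero
    \<open>\<beta> j\<close> make the blocks \<open>c j\<close> invertible.\<close>
  define c where "c j = mat 1 1 (\<lambda>_. \<beta> (Suc j))" for j
  define G where "G j = mat 1 1 (\<lambda>_. inverse (\<beta> (Suc j)))" for j
  define B where "B = (\<Prod>m=1..k. \<beta> m)"
  have B: "B \<noteq> 0" using b by (auto simp: B_def)
  have sh: "(\<Prod>i<k. h (Suc i)) = (\<Prod>m=1..k. h m)" for h :: "nat \<Rightarrow> complex"
    by (simp add: prod.atLeast1_atMost_eq)
  have "phi_b k z (\<lambda>j. - \<beta> j) (\<lambda>_. 1) = block_mat 1 k (\<lambda>i j. (if i = j then 1\<^sub>m 1 else 0\<^sub>m 1 1)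
      + (if i = Suc j then - c j else 0\<^sub>m 1 1)
      + (if i = 0 \<and> Suc j = k then - (inverse z \<cdot>\<^sub>m c j) else 0\<^sub>m 1 1))"
    by (intro eq_matI) (auto simp: phi_b_def sqmat1_def block_mat_def c_def)
  also have "det \<dots> = (\<Prod>i<k. det (c i)) *
      det (foldr (\<lambda>i M. 1\<^sub>m 1 * G i * M) [0..<k] (1\<^sub>m 1) - inverse z \<cdot>\<^sub>m 1\<^sub>m 1)"
  proof (rule det_block_mat_bidiagonal_cyclic)
    show "c i * G i = 1\<^sub>m 1" if "i < k" for i
      using b[of "Suc i"] that by (intro eq_matI) (auto simp: c_def G_def scalar_prod_def)
  qed (use k in \<open>auto simp: c_def G_def\<close>)
  also have "foldr (\<lambda>i M. 1\<^sub>m 1 * G i * M) xs (1\<^sub>m 1)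
      = mat 1 1 (\<lambda>_. prod_list (map (\<lambda>i. inverse (\<beta> (Suc i))) xs))" for xs
    by (induction xs) (auto simp: G_def scalar_prod_def)
  also have "prod_list (map (\<lambda>i. inverse (\<beta> (Suc i))) [0..<k]) = inverse B"
    using sh[of "\<lambda>i. inverse (\<beta> i)"]
    by (simp add: prod.distinct_set_conv_list[symmetric] atLeast0LessThan B_def prod_inversef[symmetric] o_def)
  also have "(\<Prod>i<k. det (c i)) = B" using sh[of \<beta>] by (simp add: c_def B_def det_single)
  \<comment> \<open>The formula has produced \<open>B * (inverse B - inverse z)\<close>.\<close>
  finally show ?thesis
    unfolding B_def[symmetric] using B
    by (simp add: det_single[OF minus_carrier_mat] algebra_simps)
qed

section \<open>The Kasteleyn matrix, the product \<open>Phi\<close> and their comparison\<close>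

text \<open>The blocks of \<open>K_G1\<close> are themselves transposes, so transposing the whole
  matrix restores \<open>phi_b\<close> in each block. The corner moves to the top right, hence into
  the last block column, and so carries the same \<open>c j\<close> as its column index
  demands.\<close>

lemma transpose_K_G1:
  "(K_G1 k l \<alpha> \<beta> \<gamma> z w)\<^sup>T = block_mat k l (\<lambda>i j.
      (if i = j then phi_b k z (par_vec \<alpha> (i + 1)) (par_vec \<gamma> (i + 1)) else 0\<^sub>m k k)
      + (if i = Suc j then - phi_b k z (\<lambda>m. - par_vec \<beta> (j + 1) m) (\<lambda>_. 1) else 0\<^sub>m k k)
      + (if i = 0 \<and> Suc j = l then - (w \<cdot>\<^sub>m phi_b k z (\<lambda>m. - par_vec \<beta> (j + 1) m) (\<lambda>_. 1))
         else 0\<^sub>m k k))" (is "_ = ?R")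
proof (rule eq_matI)
  fix p q assume "p < dim_row ?R" "q < dim_col ?R"
  then have p: "p < k * l" and q: "q < k * l" by (auto simp: block_mat_def)
  have k: "k > 0" using p by (cases k) auto
  have [simp]: "dim_row (phi_b k z a b) = k" "dim_col (phi_b k z a b) = k" for a b
    using phi_b_carrier[of k z a b] by (auto simp del: phi_b_carrier)
  let ?c = "\<lambda>j. phi_b k z (\<lambda>m. - par_vec \<beta> (j + 1) m) (\<lambda>_. 1)"
  \<comment> \<open>Both the block position and the position inside the block are swapped;
    \<open>+ 1\<close> passes to the 1-based block indices.\<close>
  have "K_block k l \<alpha> \<beta> \<gamma> z w (j + 1) (i + 1) $$ (s, r) =
      ((if i = j then phi_b k z (par_vec \<alpha> (i + 1)) (par_vec \<gamma> (i + 1)) else 0\<^sub>m k k)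
      + (if i = Suc j then - ?c j else 0\<^sub>m k k)
      + (if i = 0 \<and> Suc j = l then - (w \<cdot>\<^sub>m ?c j) else 0\<^sub>m k k)) $$ (r, s)"
    if "r < k" "s < k" for i j r s
    using that by (auto simp: K_block_def block_A_def block_B_def)
  then show "(K_G1 k l \<alpha> \<beta> \<gamma> z w)\<^sup>T $$ (p, q) = ?R $$ (p, q)"
    using p q k by (simp add: K_G1_def block_mat_def)
qed (auto simp: K_G1_def block_mat_def)

text \<open>The factors numbered \<open>2 * i + 1\<close> and \<open>2 * i + 2\<close> are grouped
  into one.\<close>

lemma Phi_eq:
  "Phi k l \<alpha> \<beta> \<gamma> z = foldr (\<lambda>i M. phi_b k z (par_vec \<alpha> (i + 1)) (par_vec \<gamma> (i + 1))
      * phi_g k z (par_vec \<beta> (i + 1)) * M) [0..<l] (1\<^sub>m k)"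
proof -
  \<comment> \<open>The start value \<open>N\<close> is generalised because the induction peels the
    last pair of factors off the list and absorbs it into \<open>N\<close>.\<close>
  have "foldr (\<lambda>m M. phi_factor k \<alpha> \<beta> \<gamma> z m * M) [1..<2 * l + 1] N
      = foldr (\<lambda>i M. phi_b k z (par_vec \<alpha> (i + 1)) (par_vec \<gamma> (i + 1))
      * phi_g k z (par_vec \<beta> (i + 1)) * M) [0..<l] N" if "N \<in> carrier_mat k k" for N
    using that
  proof (induction l arbitrary: N)
    case (Suc l)
    let ?a = "phi_b k z (par_vec \<alpha> (l + 1)) (par_vec \<gamma> (l + 1))"
    let ?g = "phi_g k z (par_vec \<beta> (l + 1))"
    have N: "?a * (?g * N) \<in> carrier_mat k k" "?a * (?g * N) = ?a * ?g * N"
      using Suc.prems by (auto intro!: mult_carrier_mat[of _ k k] assoc_mult_mat[symmetric, of _ k k _ k _ k])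
    have "foldr (\<lambda>m M. phi_factor k \<alpha> \<beta> \<gamma> z m * M) [1..<2 * Suc l + 1] N
      = foldr (\<lambda>m M. phi_factor k \<alpha> \<beta> \<gamma> z m * M) [1..<2 * l + 1]
        (?a * (?g * N))"
      by (simp add: phi_factor_def)
    also have "\<dots> = foldr (\<lambda>i M. phi_b k z (par_vec \<alpha> (i + 1)) (par_vec \<gamma> (i + 1))
      * phi_g k z (par_vec \<beta> (i + 1)) * M) [0..<l] (?a * ?g * N)"
      unfolding N(2)[symmetric] by (rule Suc.IH[OF N(1)])
    finally have eq: "foldr (\<lambda>m M. phi_factor k \<alpha> \<beta> \<gamma> z m * M) [1..<2 * Suc l + 1] N = \<dots>" .
    show ?case by (subst eq) simp
  qed simp
  then show ?thesis unfolding Phi_def by simp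
qed

theorem proposition1p2:
  fixes k l :: nat
    and \<alpha> \<beta> \<gamma> :: "nat \<Rightarrow> nat \<Rightarrow> real"
    and z w :: complex
  assumes "k \<ge> 1" and "l \<ge> 1"
    and "\<And>j i. 1 \<le> j \<Longrightarrow> j \<le> k \<Longrightarrow> 1 \<le> i \<Longrightarrow> i \<le> l \<Longrightarrow> \<alpha> j i > 0"
    and "\<And>j i. 1 \<le> j \<Longrightarrow> j \<le> k \<Longrightarrow> 1 \<le> i \<Longrightarrow> i \<le> l \<Longrightarrow> \<beta> j i > 0"
    and "\<And>j i. 1 \<le> j \<Longrightarrow> j \<le> k \<Longrightarrow> 1 \<le> i \<Longrightarrow> i \<le> l \<Longrightarrow> \<gamma> j i > 0"
    and "z \<noteq> 0"
    and "\<And>i. 1 \<le> i \<Longrightarrow> i \<le> l \<Longrightarrow> z \<noteq> complex_of_real (beta_v k \<beta> i)"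
  shows "char_P k l \<alpha> \<beta> \<gamma> z w = det (K_G1 k l \<alpha> \<beta> \<gamma> z w)"
proof -
  have bv: "(\<Prod>m=1..k. par_vec \<beta> i m) = complex_of_real (beta_v k \<beta> i)" for i
    by (simp add: par_vec_def beta_v_def)
  let ?c = "\<lambda>i. phi_b k z (\<lambda>m. - par_vec \<beta> (i + 1) m) (\<lambda>_. 1)"
  have det_c: "det (?c i) = 1 - complex_of_real (beta_v k \<beta> (i + 1)) * inverse z" if "i < l" for i
    unfolding bv[symmetric]
  proof (rule det_phi_b_one[OF assms(1)])
    show "par_vec \<beta> (i + 1) j \<noteq> 0" if "1 \<le> j" "j \<le> k" for j
      using assms(4)[OF that, of "i + 1"] \<open>i < l\<close> by (simp add: par_vec_def)
  qed
  \<comment> \<open>In the transpose the \<open>phi_b\<close> blocks precede their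
    \<open>phi_g\<close> partners, in the order of the factors of \<open>Phi\<close>.\<close>
  have "det (K_G1 k l \<alpha> \<beta> \<gamma> z w) = det ((K_G1 k l \<alpha> \<beta> \<gamma> z w)\<^sup>T)"
    by (rule det_transpose[symmetric, of _ "k * l"]) (simp add: K_G1_def)
  also have "\<dots> = (\<Prod>i<l. det (?c i)) * det (Phi k l \<alpha> \<beta> \<gamma> z - w \<cdot>\<^sub>m 1\<^sub>m k)"
    unfolding transpose_K_G1 Phi_eq
  proof (rule det_block_mat_bidiagonal_cyclic)
    \<comment> \<open>Avoiding the pole \<open>beta_v k \<beta> (i + 1)\<close> is exactly the
      condition for \<open>phi_g\<close> to invert \<open>?c i\<close>.\<close>
    show "?c i * phi_g k z (par_vec \<beta> (i + 1)) = 1\<^sub>m k" if "i < l" for i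
      using assms(6) assms(7)[of "i + 1"] that
      by (intro phi_b_mult_phi_g, unfold bv) (simp add: field_simps)
  qed (use assms(2) in auto)
  also have "(\<Prod>i<l. det (?c i)) = (\<Prod>i=1..l. 1 - complex_of_real (beta_v k \<beta> i) * inverse z)"
    unfolding One_nat_def prod.atLeast1_atMost_eq by (intro prod.cong) (use det_c in auto)
  finally show ?thesis by (simp add: char_P_def)
qed

end
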